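(* Let $f:\mathbb{R}^d\to\mathbb{R}$ be bounded below with $L$-Lipschitz gradient, satisfying the global Kurdyka-Łojasiewicz inequality with function $\phi$, and let the stochastic gradient estimators $g_k(x,\xi)$ satisfy the expected smoothness condition of order $k$ with function $h$, constants $A,B,C\ge 0$ and costs $b_k$. Put $a:=LA$ and $d:=LC/2$, and run SGD with restarts with step-sizes $\{\eta_k\}$. For each $k$ let $r(\eta_k)$ denote the stationary point, i.e. the solution $t$ of $$a\eta_k^2\,h(t)+\frac{d\eta_k^2}{b_k}=\frac{\eta_k}{2}\phi^2(t).$$ Suppose there exist $\nu\ge 0$, $\{\omega_j\}_{j\ge 0}$ and $\zeta\ge 0$ such that $\eta_k=\Theta(k^{-\zeta})$, $r(\eta_k)=\Theta(k^{-\zeta\nu})$, $|1-\omega_k|<1$, and $$1+a\eta_k^2\,h'\big(r(\eta_k)\big)-\eta_k\,\phi'\big(r(\eta_k)\big)\,\phi\big(r(\eta_k)\big)=1-\omega_k k^{-1}.$$ Then $\delta_k=\mathcal{O}(k^{-\zeta\nu})$, and the iteration complexity of SGD with restarts with inner-loop length $T=\Omega(1/\min_j\omega_j)$ is $\mathcal{O}(\epsilon_f^{-1/(\zeta\nu)})$.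
   Context: $f^*:=\inf_x f(x)>-\infty$. Global Kurdyka-Łojasiewicz (KŁ) inequality with $\phi$: $\phi:\mathbb{R}^+\to\mathbb{R}^+$ is continuous, $\phi(0)=0$, $\phi^2$ is convex, and $\|\nabla f(x)\|\ge\phi(f(x)-f^* )$ for all $x\in\mathbb{R}^d$. Expected smoothness of order $k$: $g_k(x,\xi)$ is an unbiased estimator of $\nabla f(x)$ (expectation over $\xi\sim\mathcal{D}$) and $$\mathbb{E}\|g_k(x,\xi)\|^2\le 2A\,h(f(x)-f^* )+B\|\nabla f(x)\|^2+\frac{C}{b_k}\quad\text{for all }x\in\mathbb{R}^d,$$ where $A,B,C\ge0$, and $h:\mathbb{R}^+\to\mathbb{R}^+$ is concave and continuously differentiable with $h'\ge0$, $h(0)=0$. The number $b_k$ is called the cost of the estimator. SGD with restarts: given an initial $x$, integers $T,K$ and step-sizes $\{\eta_k\}$, for each outer iteration $k=0,\dots,K-1$ perform $T$ inner updates $x\leftarrow x-\eta_k\,g_k(x,\xi_t)$, $t=0,\dots,T-1$, with independent random vectors $\xi_t$; return the final $x$. $\delta_k$ is the expected optimality gap $\mathbb{E}[f(x)-f^*]$ of the iterate $x$ after $k$ outer-loop iterations. The iteration complexity is the total number $K\cdot T$ of updates needed to obtain $\mathbb{E}[f(x)-f^*]\le\epsilon_f$.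
   Formalization: Adds that LBη_k ≤ 1 for all large k (automatic if ζ>0; for ζ=0 the claim fails without it); the condition T ≥ c/inf_j ω_j, with inf_j ω_j > 0, is imposed for the bound on δ_k too (false for small T); the complexity bound is for ζν>0. *)

theory Defs
  imports "HOL-Probability.Probability" "HOL-Library.Landau_Symbols"
begin

text \<open>Functions on the closed half-line of nonnegative reals are total functions on the reals
  of which only the restriction to \<open>{0..}\<close> matters; derivatives at \<open>0\<close> are one-sided.\<close>

definition smooth_fun :: "('a::euclidean_space \<Rightarrow> real) \<Rightarrow> ('a \<Rightarrow> 'a) \<Rightarrow> real \<Rightarrow> bool" where
  "smooth_fun f gradf L \<longleftrightarrow>
     bdd_below (range f) \<and> (\<forall>x. GDERIV f x :> gradf x) \<and> L-lipschitz_on UNIV gradf"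

definition opt_gap :: "('a \<Rightarrow> real) \<Rightarrow> 'a \<Rightarrow> real" where
  "opt_gap f x = f x - (INF y. f y)"

definition global_KL ::
  "('a::real_normed_vector \<Rightarrow> real) \<Rightarrow> ('a \<Rightarrow> 'a) \<Rightarrow> (real \<Rightarrow> real) \<Rightarrow> bool" where
  "global_KL f gradf \<phi> \<longleftrightarrow>
     continuous_on {0..} \<phi> \<and> (\<forall>t\<ge>0. \<phi> t \<ge> 0) \<and> \<phi> 0 = 0 \<and>
     convex_on {0..} (\<lambda>t. (\<phi> t)\<^sup>2) \<and>
     (\<forall>x. norm (gradf x) \<ge> \<phi> (opt_gap f x))"

definition growth_fun :: "(real \<Rightarrow> real) \<Rightarrow> (real \<Rightarrow> real) \<Rightarrow> bool" where
  "growth_fun h h' \<longleftrightarrow>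
     concave_on {0..} h \<and> (\<forall>t\<ge>0. h t \<ge> 0) \<and> h 0 = 0 \<and>
     (\<forall>t\<ge>0. (h has_real_derivative h' t) (at t within {0..})) \<and>
     continuous_on {0..} h' \<and> (\<forall>t\<ge>0. h' t \<ge> 0)"

text \<open>The order of the condition enters only through the estimator \<open>g\<close> and its cost \<open>b\<close>.\<close>

definition expected_smoothness ::
  "'s measure \<Rightarrow> ('a::euclidean_space \<Rightarrow> 's \<Rightarrow> 'a) \<Rightarrow> ('a \<Rightarrow> real) \<Rightarrow> ('a \<Rightarrow> 'a) \<Rightarrow>
   (real \<Rightarrow> real) \<Rightarrow> real \<Rightarrow> real \<Rightarrow> real \<Rightarrow> real \<Rightarrow> bool" where
  "expected_smoothness D g f gradf h A B C b \<longleftrightarrow>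
     case_prod g \<in> borel_measurable (borel \<Otimes>\<^sub>M D) \<and>
     (\<forall>x. integrable D (g x) \<and> (\<integral>\<xi>. g x \<xi> \<partial>D) = gradf x) \<and>
     (\<forall>x. integrable D (\<lambda>\<xi>. (norm (g x \<xi>))\<^sup>2) \<and>
          (\<integral>\<xi>. (norm (g x \<xi>))\<^sup>2 \<partial>D) \<le>
            2 * A * h (opt_gap f x) + B * (norm (gradf x))\<^sup>2 + C / b)"

primrec sgd_inner ::
  "('a::real_vector \<Rightarrow> 's \<Rightarrow> 'a) \<Rightarrow> real \<Rightarrow> (nat \<Rightarrow> 's) \<Rightarrow> 'a \<Rightarrow> nat \<Rightarrow> 'a" where
  "sgd_inner g \<eta> \<xi> x 0 = x"
| "sgd_inner g \<eta> \<xi> x (Suc t) =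
     sgd_inner g \<eta> \<xi> x t - \<eta> *\<^sub>R g (sgd_inner g \<eta> \<xi> x t) (\<xi> t)"

primrec sgd_restarts ::
  "(nat \<Rightarrow> 'a::real_vector \<Rightarrow> 's \<Rightarrow> 'a) \<Rightarrow> (nat \<Rightarrow> real) \<Rightarrow> nat \<Rightarrow> 'a \<Rightarrow> (nat \<Rightarrow> nat \<Rightarrow> 's) \<Rightarrow>
   nat \<Rightarrow> 'a" where
  "sgd_restarts g \<eta> T x \<xi> 0 = x"
| "sgd_restarts g \<eta> T x \<xi> (Suc k) =
     sgd_inner (g k) (\<eta> k) (\<xi> k) (sgd_restarts g \<eta> T x \<xi> k) T"

definition sample_stream ::
  "'w measure \<Rightarrow> 's measure \<Rightarrow> nat \<Rightarrow> (nat \<Rightarrow> nat \<Rightarrow> 'w \<Rightarrow> 's) \<Rightarrow> bool" where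
  "sample_stream M D T \<xi> \<longleftrightarrow>
     prob_space M \<and> prob_space D \<and>
     prob_space.indep_vars M (\<lambda>_. D) (\<lambda>(k, t). \<xi> k t) (UNIV \<times> {..<T}) \<and>
     (\<forall>k. \<forall>t<T. distr M D (\<xi> k t) = D)"

definition restart_gap ::
  "('a::real_vector \<Rightarrow> real) \<Rightarrow> (nat \<Rightarrow> 'a \<Rightarrow> 's \<Rightarrow> 'a) \<Rightarrow> (nat \<Rightarrow> real) \<Rightarrow> nat \<Rightarrow> 'a \<Rightarrow>
   (nat \<Rightarrow> nat \<Rightarrow> 'w \<Rightarrow> 's) \<Rightarrow> nat \<Rightarrow> 'w \<Rightarrow> real" where
  "restart_gap f g \<eta> T x \<xi> k w = opt_gap f (sgd_restarts g \<eta> T x (\<lambda>j t. \<xi> j t w) k)"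

text \<open>Extended-real valued, so that an accuracy which is never reached has complexity \<open>\<infinity>\<close>.\<close>

definition iteration_complexity :: "nat \<Rightarrow> (nat \<Rightarrow> real) \<Rightarrow> real \<Rightarrow> ereal" where
  "iteration_complexity T \<delta> \<epsilon> = Inf {ereal (real (K * T)) | K. \<delta> K \<le> \<epsilon>}"

definition stationary_point ::
  "real \<Rightarrow> real \<Rightarrow> (real \<Rightarrow> real) \<Rightarrow> (real \<Rightarrow> real) \<Rightarrow> real \<Rightarrow> real \<Rightarrow> real \<Rightarrow> bool" where
  "stationary_point a d h \<phi> b \<eta> t \<longleftrightarrow>
     t \<ge> 0 \<and> a * \<eta>\<^sup>2 * h t + d * \<eta>\<^sup>2 / b = \<eta> / 2 * (\<phi> t)\<^sup>2"

end

theory Submission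
  imports Defs
begin

text \<open>One step of SGD with step-size \<open>\<eta>\<close> from \<open>x\<close> has, by smoothness, expected smoothness and the KL
  inequality, an expected gap of at most \<open>F (gap x)\<close> with
  \<open>F t = t + a \<eta>\<^sup>2 h t + d \<eta>\<^sup>2 / b - \<eta> \<phi>\<^sup>2 t / 2\<close>. This \<open>F\<close> is concave with fixed point \<open>r\<close>, hence
  below its tangent at \<open>r\<close>, whose slope is \<open>1 - \<omega> / k\<close>. As the bound is affine, it survives
  taking expectations, and \<open>T\<close> inner steps shrink \<open>\<delta>\<^sub>k - r\<^sub>k\<close> by
  \<open>(1 - \<omega>\<^sub>k / k) ^ T \<le> exp (- T \<omega>\<^sub>k / k)\<close>. If \<open>T \<omega>\<^sub>k \<ge> \<zeta> \<nu> + 1\<close>, this is faster than the decay of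
  \<open>k powr (- \<zeta> \<nu>)\<close>, so \<open>\<delta>\<^sub>k\<close> tracks \<open>r\<^sub>k\<close>.\<close>

section \<open>Tangent inequalities for convex and concave functions on the half-line\<close>

text \<open>On the segment from \<open>r\<close> to \<open>t\<close>, convexity bounds every
  difference quotient at \<open>r\<close> by \<open>F t - F r\<close>; letting the parameter tend to
  0 from the right gives the claim. The derivative is taken within \<open>S\<close>, so
  \<open>r\<close> may be a boundary point, in particular the endpoint 0 of the half-line.\<close>

lemma convex_on_above_tangent_within:
  fixes F :: "real \<Rightarrow> real"
  assumes conv: "convex_on S F" and r: "r \<in> S" and t: "t \<in> S"
    and der: "(F has_real_derivative F') (at r within S)"
  shows "F t \<ge> F r + F' * (t - r)"
proof -
  define p where "p s = r + s * (t - r)" for s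
  have seg: "p s \<in> S" and below: "F (p s) \<le> F r + s * (F t - F r)" if "s \<in> {0..1}" for s
  proof -
    have p: "p s = (1 - s) *\<^sub>R r + s *\<^sub>R t" by (simp add: p_def algebra_simps)
    show "p s \<in> S"
      unfolding p using convexD[OF convex_on_imp_convex[OF conv] r t, of "1 - s" s] that by simp
    show "F (p s) \<le> F r + s * (F t - F r)"
      unfolding p using convex_onD[OF conv, of s r t] that r t by (simp add: algebra_simps)
  qed
  have "(F \<circ> p has_real_derivative F' * (t - r)) (at 0 within {0..1})"
  proof (rule DERIV_image_chain)
    show "(p has_real_derivative (t - r)) (at 0 within {0..1})"
      unfolding p_def by (auto intro!: derivative_eq_intros)
    show "(F has_real_derivative F') (at (p 0) within p ` {0..1})"
      using der seg by (auto simp: p_def intro: DERIV_subset)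
  qed
  then have lim: "((\<lambda>s. (F (p s) - F r) / s) \<longlongrightarrow> F' * (t - r)) (at 0 within {0..1})"
    by (simp add: has_field_derivative_iff p_def)
  have ev: "\<forall>\<^sub>F s in at (0::real) within {0..1}. (F (p s) - F r) / s \<le> F t - F r"
    unfolding eventually_at_filter
  proof (intro always_eventually allI impI)
    fix s :: real assume "s \<noteq> 0" "s \<in> {0..1}"
    then show "(F (p s) - F r) / s \<le> F t - F r"
      using below[of s] by (simp add: divide_le_eq mult.commute)
  qed
  have "at (0::real) within {0..1} \<noteq> bot"
    by (simp add: at_within_Icc_at_right)
  from tendsto_upperbound[OF lim ev this] show ?thesis by simp
qed

lemma growth_fun_tangent:
  assumes "growth_fun h h'" "r \<ge> 0" "t \<ge> 0"
  shows "h t \<le> h r + h' r * (t - r)"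
proof -
  have "convex_on {0..} (\<lambda>t. - h t)" "((\<lambda>t. - h t) has_real_derivative - h' r) (at r within {0..})"
    using assms unfolding growth_fun_def concave_on_def by (auto intro: DERIV_minus)
  from convex_on_above_tangent_within[OF this(1) _ _ this(2), of t] assms show ?thesis by simp
qed

section \<open>Smoothness, and the expected effect of one stochastic gradient step\<close>

context
  fixes f :: "'a::euclidean_space \<Rightarrow> real" and gradf :: "'a \<Rightarrow> 'a" and L :: real
  assumes smooth: "smooth_fun f gradf L"
begin

lemma smooth_fun_L_nonneg: "L \<ge> 0"
  using smooth lipschitz_on_nonneg unfolding smooth_fun_def by blast

lemma smooth_fun_Inf_le: "(INF y. f y) \<le> f x"
  using smooth unfolding smooth_fun_def by (auto intro: cINF_lower)

lemma opt_gap_nonneg: "opt_gap f x \<ge> 0"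
  using smooth_fun_Inf_le[of x] by (simp add: opt_gap_def)

lemma opt_gap_borel: "opt_gap f \<in> borel_measurable borel"
proof -
  have "continuous_on UNIV f"
    using smooth unfolding smooth_fun_def gderiv_def
    by (meson continuous_at_imp_continuous_on has_derivative_continuous)
  then have "f \<in> borel_measurable borel"
    by (rule borel_measurable_continuous_onI)
  then show ?thesis
    unfolding opt_gap_def[abs_def] by simp
qed

text \<open>Along the segment, \<open>u\<close> is \<open>f\<close> minus the terms of the claimed
  bound that vary with \<open>s\<close>. Cauchy-Schwarz and the Lipschitz gradient make its
  derivative nonpositive for \<open>s \<ge> 0\<close>, and the bound is
  \<open>u 1 \<le> u 0\<close>.\<close>

lemma smooth_fun_descent:
  "f (x + v) \<le> f x + v \<bullet> gradf x + L / 2 * (norm v)\<^sup>2"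
proof -
  define u where
    "u s = f (x + s *\<^sub>R v) - s * (v \<bullet> gradf x) - L / 2 * s\<^sup>2 * (norm v)\<^sup>2" for s
  have der: "(u has_real_derivative
      (v \<bullet> gradf (x + s *\<^sub>R v) - v \<bullet> gradf x - L * s * (norm v)\<^sup>2)) (at s)" for s
  proof -
    have "(f has_derivative (\<lambda>h. h \<bullet> gradf (x + s *\<^sub>R v))) (at (x + s *\<^sub>R v))"
      using smooth unfolding smooth_fun_def gderiv_def by blast
    moreover have "((\<lambda>s. x + s *\<^sub>R v) has_derivative (\<lambda>h. h *\<^sub>R v)) (at s)"
      by (auto intro!: derivative_eq_intros)
    ultimately have "((\<lambda>s. f (x + s *\<^sub>R v)) has_derivative
        (\<lambda>h. (h *\<^sub>R v) \<bullet> gradf (x + s *\<^sub>R v))) (at s)"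
      using has_derivative_compose[of "\<lambda>s. x + s *\<^sub>R v" "\<lambda>h. h *\<^sub>R v" s UNIV f] by blast
    then have "((\<lambda>s. f (x + s *\<^sub>R v)) has_real_derivative v \<bullet> gradf (x + s *\<^sub>R v)) (at s)"
      by (simp add: has_field_derivative_def mult_commute_abs)
    then show ?thesis
      unfolding u_def by (auto intro!: derivative_eq_intros)
  qed
  have "v \<bullet> gradf (x + s *\<^sub>R v) - v \<bullet> gradf x - L * s * (norm v)\<^sup>2 \<le> 0" if "s \<ge> 0" for s
  proof -
    have "v \<bullet> gradf (x + s *\<^sub>R v) - v \<bullet> gradf x = v \<bullet> (gradf (x + s *\<^sub>R v) - gradf x)"
      by (simp add: inner_diff_right)
    also have "\<dots> \<le> norm v * norm (gradf (x + s *\<^sub>R v) - gradf x)"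
      by (rule norm_cauchy_schwarz)
    also have "\<dots> \<le> norm v * (L * norm (s *\<^sub>R v))"
    proof -
      have "dist (gradf (x + s *\<^sub>R v)) (gradf x) \<le> L * dist (x + s *\<^sub>R v) x"
        using smooth unfolding smooth_fun_def by (blast intro: lipschitz_onD UNIV_I)
      then show ?thesis by (intro mult_left_mono) (simp_all add: dist_norm)
    qed
    also have "\<dots> = L * s * (norm v)\<^sup>2"
      using that by (simp add: power2_eq_square)
    finally show ?thesis by simp
  qed
  then have "u 1 \<le> u 0"
    using der by (intro DERIV_nonpos_imp_nonincreasing[of 0 1 u]) (simp, metis)
  then show ?thesis by (simp add: u_def)
qed

text \<open>A gradient step of length \<open>1 / (L + 1)\<close> cannot take \<open>f\<close> below
  its infimum. Using \<open>L + 1\<close> in place of \<open>L\<close> keeps the step-size defined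
  when \<open>L = 0\<close>.\<close>

lemma smooth_fun_grad_sq_le: "(norm (gradf x))\<^sup>2 \<le> 2 * (L + 1) * opt_gap f x"
proof -
  define s where "s = 1 / (L + 1)"
  have s: "s > 0" "L * s \<le> 1" "s * (L + 1) = 1"
    using smooth_fun_L_nonneg by (auto simp: s_def field_simps)
  have "(INF y. f y) \<le> f (x + (- s) *\<^sub>R gradf x)" by (rule smooth_fun_Inf_le)
  also have "\<dots> \<le> f x + ((- s) *\<^sub>R gradf x) \<bullet> gradf x + L / 2 * (norm ((- s) *\<^sub>R gradf x))\<^sup>2"
    by (rule smooth_fun_descent)
  also have "\<dots> = f x - s * (norm (gradf x))\<^sup>2 + (L * s) * (s * (norm (gradf x))\<^sup>2 / 2)"
    by (simp add: power_mult_distrib power2_norm_eq_inner[symmetric] power2_eq_square algebra_simps)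
  also have "\<dots> \<le> f x - s * (norm (gradf x))\<^sup>2 + 1 * (s * (norm (gradf x))\<^sup>2 / 2)"
    using s by (intro add_left_mono mult_right_mono) auto
  finally have "s * (norm (gradf x))\<^sup>2 \<le> 2 * opt_gap f x" by (simp add: opt_gap_def)
  then have "(L + 1) * (s * (norm (gradf x))\<^sup>2) \<le> (L + 1) * (2 * opt_gap f x)"
    using smooth_fun_L_nonneg by (intro mult_left_mono) auto
  moreover have "(L + 1) * (s * (norm (gradf x))\<^sup>2) = (norm (gradf x))\<^sup>2"
    using s(3) by (metis mult.assoc mult.commute mult_1)
  ultimately show ?thesis by (simp add: algebra_simps)
qed

text \<open>The descent inequality is applied to the displacement
  \<open>- \<eta> *\<^sub>R g x \<xi>\<close> and integrated: unbiasedness turns the inner product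
  into the squared gradient norm, and expected smoothness bounds the second moment.\<close>

lemma expected_descent:
  assumes D: "prob_space D" and es: "expected_smoothness D g f gradf h A B C b"
    and \<eta>: "\<eta> \<ge> 0"
  shows "integrable D (\<lambda>\<xi>. opt_gap f (x - \<eta> *\<^sub>R g x \<xi>))" (is ?int)
    and "(\<integral>\<xi>. opt_gap f (x - \<eta> *\<^sub>R g x \<xi>) \<partial>D) \<le>
      opt_gap f x + L * A * \<eta>\<^sup>2 * h (opt_gap f x) + L * C / 2 * \<eta>\<^sup>2 / b
        - \<eta> * (1 - L * B * \<eta> / 2) * (norm (gradf x))\<^sup>2" (is ?le)
proof -
  interpret D: prob_space D by fact
  have gm: "case_prod g \<in> borel_measurable (borel \<Otimes>\<^sub>M D)"
    and g1: "integrable D (g x)" "(\<integral>\<xi>. g x \<xi> \<partial>D) = gradf x"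
    and g2: "integrable D (\<lambda>\<xi>. (norm (g x \<xi>))\<^sup>2)"
    and g2le: "(\<integral>\<xi>. (norm (g x \<xi>))\<^sup>2 \<partial>D) \<le>
      2 * A * h (opt_gap f x) + B * (norm (gradf x))\<^sup>2 + C / b"
    using es unfolding expected_smoothness_def by auto
  define u where
    "u \<xi> = opt_gap f x - \<eta> * (g x \<xi> \<bullet> gradf x) + L / 2 * \<eta>\<^sup>2 * (norm (g x \<xi>))\<^sup>2" for \<xi>
  have u: "integrable D u"
    unfolding u_def using g1(1) g2 by (intro Bochner_Integration.integrable_add
        Bochner_Integration.integrable_diff integrable_mult_right integrable_inner_left) auto
  have Eu: "(\<integral>\<xi>. u \<xi> \<partial>D) = opt_gap f x - \<eta> * (norm (gradf x))\<^sup>2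
      + L / 2 * \<eta>\<^sup>2 * (\<integral>\<xi>. (norm (g x \<xi>))\<^sup>2 \<partial>D)"
    unfolding u_def using g1 g2 by (simp add: D.prob_space power2_norm_eq_inner)
  have le: "opt_gap f (x - \<eta> *\<^sub>R g x \<xi>) \<le> u \<xi>" for \<xi>
    using smooth_fun_descent[of x "- (\<eta> *\<^sub>R g x \<xi>)"]
    by (simp add: opt_gap_def u_def power_mult_distrib algebra_simps)
  have meas: "(\<lambda>\<xi>. opt_gap f (x - \<eta> *\<^sub>R g x \<xi>)) \<in> borel_measurable D"
    using g1(1) by (intro measurable_compose[OF _ opt_gap_borel]) (auto dest: borel_measurable_integrable)
  \<comment> \<open>The gap is nonnegative, so the one-sided bound by the integrable
    \<open>u\<close> already dominates its absolute value.\<close>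
  show int: ?int
    by (rule Bochner_Integration.integrable_bound[OF u meas])
       (use le opt_gap_nonneg in \<open>auto intro!: AE_I2 simp: order_trans[OF _ abs_ge_self]\<close>)
  have "(\<integral>\<xi>. opt_gap f (x - \<eta> *\<^sub>R g x \<xi>) \<partial>D) \<le> (\<integral>\<xi>. u \<xi> \<partial>D)"
    by (rule integral_mono[OF int u le])
  also have "\<dots> \<le> opt_gap f x - \<eta> * (norm (gradf x))\<^sup>2 + L / 2 * \<eta>\<^sup>2 *
      (2 * A * h (opt_gap f x) + B * (norm (gradf x))\<^sup>2 + C / b)"
    unfolding Eu using g2le smooth_fun_L_nonneg by (intro add_left_mono mult_left_mono) auto
  also have "\<dots> = opt_gap f x + L * A * \<eta>\<^sup>2 * h (opt_gap f x) + L * C / 2 * \<eta>\<^sup>2 / b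
        - \<eta> * (1 - L * B * \<eta> / 2) * (norm (gradf x))\<^sup>2"
    by (simp add: algebra_simps power2_eq_square)
  finally show ?le .
qed

text \<open>A crude bound for step-sizes of any magnitude. It carries integrability through the
  early outer iterations, where \<open>L * B * \<eta> k \<le> 1\<close> may fail; only the existence
  of the constants matters.\<close>

lemma expected_gap_affine_bound:
  assumes D: "prob_space D" and es: "expected_smoothness D g f gradf h A B C b"
    and \<eta>: "\<eta> \<ge> 0" and h: "growth_fun h h'" and nonneg: "A \<ge> 0" "B \<ge> 0"
  shows "\<exists>\<alpha> \<beta>. \<forall>x. (\<integral>\<xi>. opt_gap f (x - \<eta> *\<^sub>R g x \<xi>) \<partial>D) \<le> \<alpha> * opt_gap f x + \<beta>"
proof (intro exI allI)
  fix x
  let ?G = "opt_gap f x" and ?n = "(norm (gradf x))\<^sup>2"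
  have L: "L \<ge> 0" by (rule smooth_fun_L_nonneg)
  \<comment> \<open>The tangent of \<open>h\<close> at 0, where \<open>h\<close> vanishes.\<close>
  have "h ?G \<le> h' 0 * ?G"
    using growth_fun_tangent[OF h, of 0 ?G] h opt_gap_nonneg by (simp add: growth_fun_def)
  then have 1: "L * A * \<eta>\<^sup>2 * h ?G \<le> L * A * \<eta>\<^sup>2 * (h' 0 * ?G)"
    using L nonneg by (intro mult_left_mono) auto
  have 2: "L * B * \<eta>\<^sup>2 / 2 * ?n \<le> L * B * \<eta>\<^sup>2 / 2 * (2 * (L + 1) * ?G)"
    using L nonneg by (intro mult_left_mono smooth_fun_grad_sq_le) auto
  have 3: "\<eta> * (1 - L * B * \<eta> / 2) * ?n = \<eta> * ?n - L * B * \<eta>\<^sup>2 / 2 * ?n"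
    by (simp add: algebra_simps power2_eq_square)
  have 4: "\<eta> * ?n \<ge> 0" using \<eta> by simp
  show "(\<integral>\<xi>. opt_gap f (x - \<eta> *\<^sub>R g x \<xi>) \<partial>D) \<le>
      (1 + L * A * \<eta>\<^sup>2 * h' 0 + L * B * \<eta>\<^sup>2 / 2 * (2 * (L + 1))) * ?G + L * C / 2 * \<eta>\<^sup>2 / b"
    using expected_descent(2)[OF D es \<eta>, of x] 1 2 3 4 by (simp only: ring_distribs mult_1)
qed

text \<open>Tangents at \<open>r\<close> replace \<open>h\<close> from above and the square of
  \<open>\<phi>\<close> from below. Their constant terms cancel against the noise term by the
  stationarity equation, which leaves the line of slope \<open>q\<close> through
  \<open>(r, r)\<close>.\<close>

lemma expected_gap_contraction:
  assumes D: "prob_space D" and es: "expected_smoothness D g f gradf h A B C b"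
    and \<eta>: "\<eta> \<ge> 0" and h: "growth_fun h h'" and A: "A \<ge> 0"
    and KL: "global_KL f gradf \<phi>" and step: "L * B * \<eta> \<le> 1"
    and stat: "stationary_point (L * A) (L * C / 2) h \<phi> b \<eta> r"
    and der: "(\<phi> has_real_derivative \<phi>') (at r within {0..})"
    and q: "q = 1 + L * A * \<eta>\<^sup>2 * h' r - \<eta> * \<phi>' * \<phi> r"
  shows "(\<integral>\<xi>. opt_gap f (x - \<eta> *\<^sub>R g x \<xi>) \<partial>D) \<le> q * opt_gap f x + r * (1 - q)"
proof -
  let ?G = "opt_gap f x" and ?n = "(norm (gradf x))\<^sup>2"
  have L: "L \<ge> 0" by (rule smooth_fun_L_nonneg)
  have r: "r \<ge> 0" and fix_r: "L * A * \<eta>\<^sup>2 * h r + L * C / 2 * \<eta>\<^sup>2 / b = \<eta> / 2 * (\<phi> r)\<^sup>2"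
    using stat by (auto simp: stationary_point_def)
  have G: "?G \<ge> 0" by (rule opt_gap_nonneg)
  have 1: "L * A * \<eta>\<^sup>2 * h ?G \<le> L * A * \<eta>\<^sup>2 * (h r + h' r * (?G - r))"
    using L A growth_fun_tangent[OF h r G] by (intro mult_left_mono) auto
  have "(\<phi> ?G)\<^sup>2 \<ge> (\<phi> r)\<^sup>2 + (2 * \<phi>' * \<phi> r) * (?G - r)"
  proof (rule convex_on_above_tangent_within)
    show "convex_on {0..} (\<lambda>t. (\<phi> t)\<^sup>2)" using KL by (simp add: global_KL_def)
    show "((\<lambda>t. (\<phi> t)\<^sup>2) has_real_derivative 2 * \<phi>' * \<phi> r) (at r within {0..})"
      using der by (auto intro!: derivative_eq_intros)
  qed (use r G in auto)
  moreover have "\<phi> ?G \<le> norm (gradf x)" "\<phi> ?G \<ge> 0"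
    using KL G by (auto simp: global_KL_def)
  then have "(\<phi> ?G)\<^sup>2 \<le> ?n" by (intro power_mono)
  ultimately have "\<eta> / 2 * ((\<phi> r)\<^sup>2 + (2 * \<phi>' * \<phi> r) * (?G - r)) \<le> \<eta> / 2 * ?n"
    using \<eta> by (intro mult_left_mono) auto
  \<comment> \<open>The step-size condition lets half of the gradient term absorb the
    \<open>B\<close> term; the remaining half is the source of the factor 1/2 in the stationarity
    equation.\<close>
  also have "\<eta> / 2 * ?n \<le> \<eta> * (1 - L * B * \<eta> / 2) * ?n"
  proof (rule mult_right_mono)
    have "\<eta> * (1 / 2) \<le> \<eta> * (1 - L * B * \<eta> / 2)"
      using step \<eta> by (intro mult_left_mono) auto
    then show "\<eta> / 2 \<le> \<eta> * (1 - L * B * \<eta> / 2)" by simp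
  qed simp
  finally have 2: "\<eta> / 2 * (\<phi> r)\<^sup>2 + \<eta> * \<phi>' * \<phi> r * (?G - r) \<le> \<eta> * (1 - L * B * \<eta> / 2) * ?n"
    by (simp add: algebra_simps)
  have "q * ?G + r * (1 - q) = ?G + L * A * \<eta>\<^sup>2 * (h' r * (?G - r)) - \<eta> * \<phi>' * \<phi> r * (?G - r)"
    unfolding q by (simp add: algebra_simps)
  then show ?thesis
    using expected_descent(2)[OF D es \<eta>, of x] 1 2 fix_r
    by (simp only: distrib_left[of "L * A * \<eta>\<^sup>2"])
qed

end

section \<open>From a bound at each fixed point to a bound in expectation\<close>

text \<open>Tonelli's theorem takes the place of conditional expectation: the assumption
  \<open>joint\<close> says that \<open>Y\<close> is independent of \<open>X\<close> with law
  \<open>D\<close>, so \<open>Y\<close> can be integrated out first. As \<open>v\<close> is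
  nonnegative, integrability comes out as a conclusion.\<close>

lemma (in prob_space) expectation_le_of_conditional_bound:
  fixes u :: "'b \<Rightarrow> real" and v :: "'b \<Rightarrow> 's \<Rightarrow> real"
  assumes D: "prob_space D" and X: "X \<in> M \<rightarrow>\<^sub>M S" and Y: "Y \<in> M \<rightarrow>\<^sub>M D"
    and joint: "distr M (S \<Otimes>\<^sub>M D) (\<lambda>w. (X w, Y w)) = distr M S X \<Otimes>\<^sub>M D"
    and v: "case_prod v \<in> borel_measurable (S \<Otimes>\<^sub>M D)" and v0: "\<And>x \<xi>. v x \<xi> \<ge> 0"
    and u: "u \<in> borel_measurable S" and uX: "integrable M (\<lambda>w. u (X w))"
    and int: "\<And>x. integrable D (v x)" and le: "\<And>x. (\<integral>\<xi>. v x \<xi> \<partial>D) \<le> \<alpha> * u x + \<beta>"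
  shows "integrable M (\<lambda>w. v (X w) (Y w))"
    and "expectation (\<lambda>w. v (X w) (Y w)) \<le> \<alpha> * expectation (\<lambda>w. u (X w)) + \<beta>"
proof -
  interpret D: prob_space D by fact
  have XY: "(\<lambda>w. (X w, Y w)) \<in> M \<rightarrow>\<^sub>M S \<Otimes>\<^sub>M D" using X Y by simp
  \<comment> \<open>The coefficients carry no sign condition, but the affine expression dominates a
    nonnegative integral; hence \<open>ennreal\<close> does not truncate it.\<close>
  have pos: "\<alpha> * u x + \<beta> \<ge> 0" for x
    using le[of x] Bochner_Integration.integral_nonneg[of D "v x"] v0 by (meson order_trans)
  have meas: "(\<lambda>w. v (X w) (Y w)) \<in> borel_measurable M"
    using measurable_compose[OF XY v] by simp
  have E: "expectation (\<lambda>w. \<alpha> * u (X w) + \<beta>) = \<alpha> * expectation (\<lambda>w. u (X w)) + \<beta>"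
    using uX by (simp add: prob_space)
  have "(\<integral>\<^sup>+w. ennreal (v (X w) (Y w)) \<partial>M) =
      (\<integral>\<^sup>+z. ennreal (case_prod v z) \<partial>distr M (S \<Otimes>\<^sub>M D) (\<lambda>w. (X w, Y w)))"
    using XY v by (subst nn_integral_distr) auto
  also have "\<dots> = (\<integral>\<^sup>+x. \<integral>\<^sup>+\<xi>. ennreal (v x \<xi>) \<partial>D \<partial>distr M S X)"
    unfolding joint using v by (subst D.nn_integral_fst[symmetric]) (auto cong: measurable_cong_sets)
  also have "\<dots> \<le> (\<integral>\<^sup>+x. ennreal (\<alpha> * u x + \<beta>) \<partial>distr M S X)"
    using int v0 le by (intro nn_integral_mono) (simp add: nn_integral_eq_integral ennreal_leI)
  also have "\<dots> = (\<integral>\<^sup>+w. ennreal (\<alpha> * u (X w) + \<beta>) \<partial>M)"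
    using X u by (subst nn_integral_distr) auto
  also have "\<dots> = ennreal (\<alpha> * expectation (\<lambda>w. u (X w)) + \<beta>)"
    using uX pos by (subst nn_integral_eq_integral) (auto simp: E)
  finally have bound: "(\<integral>\<^sup>+w. ennreal (v (X w) (Y w)) \<partial>M) \<le>
      ennreal (\<alpha> * expectation (\<lambda>w. u (X w)) + \<beta>)" .
  show "integrable M (\<lambda>w. v (X w) (Y w))"
    using bound v0 meas by (intro integrableI_bounded) (auto simp: le_less_trans)
  have "expectation (\<lambda>w. \<alpha> * u (X w) + \<beta>) \<ge> 0" using pos by (intro Bochner_Integration.integral_nonneg) auto
  then show "expectation (\<lambda>w. v (X w) (Y w)) \<le> \<alpha> * expectation (\<lambda>w. u (X w)) + \<beta>"
    using bound by (intro integral_real_bounded) (auto simp: E)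
qed

section \<open>Measurability of the iterates, their independence of fresh samples, and one inner
  step in expectation\<close>

lemma measurable_sgd_inner:
  fixes g :: "'a::euclidean_space \<Rightarrow> 's \<Rightarrow> 'a"
  assumes g: "case_prod g \<in> borel_measurable (borel \<Otimes>\<^sub>M D)" and X: "X \<in> borel_measurable N"
    and Y: "\<And>s. s < t \<Longrightarrow> Y s \<in> N \<rightarrow>\<^sub>M D"
  shows "(\<lambda>w. sgd_inner g \<eta> (\<lambda>s. Y s w) (X w) t) \<in> borel_measurable N"
  using Y
proof (induction t)
  case 0
  then show ?case using X by simp
next
  case (Suc t)
  let ?Z = "\<lambda>w. sgd_inner g \<eta> (\<lambda>s. Y s w) (X w) t"
  have Z: "?Z \<in> borel_measurable N" by (rule Suc.IH) (simp add: Suc.prems)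
  have "(\<lambda>w. (?Z w, Y t w)) \<in> N \<rightarrow>\<^sub>M borel \<Otimes>\<^sub>M D"
    using Z Suc.prems[of t] by simp
  from measurable_compose[OF this g] Z show ?case by simp
qed

lemma measurable_sgd_restarts:
  fixes g :: "nat \<Rightarrow> 'a::euclidean_space \<Rightarrow> 's \<Rightarrow> 'a"
  assumes g: "\<And>k. case_prod (g k) \<in> borel_measurable (borel \<Otimes>\<^sub>M D)"
    and Y: "\<And>j s. j < k \<Longrightarrow> s < T \<Longrightarrow> Y j s \<in> N \<rightarrow>\<^sub>M D"
  shows "(\<lambda>w. sgd_restarts g \<eta> T x (\<lambda>j s. Y j s w) k) \<in> borel_measurable N"
  using Y
proof (induction k)
  case (Suc k)
  have "(\<lambda>w. sgd_restarts g \<eta> T x (\<lambda>j s. Y j s w) k) \<in> borel_measurable N"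
    by (rule Suc.IH) (simp add: Suc.prems)
  then show ?case
    using Suc.prems by (auto intro!: measurable_sgd_inner[OF g])
qed simp

lemma sgd_inner_cong:
  "(\<And>s. s < t \<Longrightarrow> \<xi> s = \<xi>' s) \<Longrightarrow> sgd_inner g \<eta> \<xi> x t = sgd_inner g \<eta> \<xi>' x t"
  by (induction t) auto

lemma sgd_restarts_cong:
  "(\<And>j s. j < k \<Longrightarrow> s < T \<Longrightarrow> \<xi> j s = \<xi>' j s) \<Longrightarrow>
    sgd_restarts g \<eta> T x \<xi> k = sgd_restarts g \<eta> T x \<xi>' k"
proof (induction k)
  case (Suc k)
  then have "sgd_restarts g \<eta> T x \<xi> k = sgd_restarts g \<eta> T x \<xi>' k" by simp
  moreover have "sgd_inner (g k) (\<eta> k) (\<xi> k) y T = sgd_inner (g k) (\<eta> k) (\<xi>' k) y T" for y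
    by (rule sgd_inner_cong) (simp add: Suc.prems)
  ultimately show ?case by simp
qed simp

definition sgd_iterate ::
  "(nat \<Rightarrow> 'a::real_vector \<Rightarrow> 's \<Rightarrow> 'a) \<Rightarrow> (nat \<Rightarrow> real) \<Rightarrow> nat \<Rightarrow> 'a \<Rightarrow> (nat \<Rightarrow> nat \<Rightarrow> 's) \<Rightarrow>
   nat \<Rightarrow> nat \<Rightarrow> 'a" where
  "sgd_iterate g \<eta> T x \<xi> k t = sgd_inner (g k) (\<eta> k) (\<xi> k) (sgd_restarts g \<eta> T x \<xi> k) t"

text \<open>The iterate is a measurable function of the samples already drawn, and
  \<open>(k, t)\<close> is not among their indices. Restrictions of an independent family to
  disjoint index sets are independent, and so are measurable images of them.\<close>

lemma distr_sgd_iterate_sample: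
  fixes g :: "nat \<Rightarrow> 'a::euclidean_space \<Rightarrow> 's \<Rightarrow> 'a" and \<eta> x k
  assumes g: "\<And>k. case_prod (g k) \<in> borel_measurable (borel \<Otimes>\<^sub>M D)"
    and ss: "sample_stream M D T \<xi>" and t: "t < T"
  defines "X \<equiv> \<lambda>w. sgd_iterate g \<eta> T x (\<lambda>j s. \<xi> j s w) k t"
  shows "X \<in> borel_measurable M" and "\<xi> k t \<in> M \<rightarrow>\<^sub>M D"
    and "distr M (borel \<Otimes>\<^sub>M D) (\<lambda>w. (X w, \<xi> k t w)) = distr M borel X \<Otimes>\<^sub>M D"
proof -
  interpret prob_space M using ss by (simp add: sample_stream_def)
  interpret D: prob_space D using ss by (simp add: sample_stream_def)
  let ?X = "\<lambda>(k, t). \<xi> k t"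
  \<comment> \<open>The samples used so far: all those of the completed outer iterations and the
    first \<open>t\<close> of the current one.\<close>
  define P where "P = {..<k} \<times> {..<T} \<union> {k} \<times> {..<t}"
  define F where "F y = sgd_iterate g \<eta> T x (\<lambda>j s. y (j, s)) k t" for y
  define G where "G y = y (k, t)" for y :: "nat \<times> nat \<Rightarrow> 's"
  define U where "U w = restrict (\<lambda>i. ?X i w) P" for w
  define V where "V w = restrict (\<lambda>i. ?X i w) {(k, t)}" for w
  let ?MP = "PiM P (\<lambda>_. D)" and ?MQ = "PiM {(k, t)} (\<lambda>_. D)"
  have "indep_vars (\<lambda>_. D) ?X (UNIV \<times> {..<T})"
    using ss by (simp add: sample_stream_def)
  then have "indep_var ?MP U ?MQ V"
    unfolding U_def V_def by (rule indep_var_restrict) (use t in \<open>auto simp: P_def\<close>)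
  then have U: "U \<in> M \<rightarrow>\<^sub>M ?MP" and V: "V \<in> M \<rightarrow>\<^sub>M ?MQ"
    and UV: "distr M ?MP U \<Otimes>\<^sub>M distr M ?MQ V = distr M (?MP \<Otimes>\<^sub>M ?MQ) (\<lambda>w. (U w, V w))"
    unfolding indep_var_distribution_eq by auto
  have F: "F \<in> ?MP \<rightarrow>\<^sub>M borel"
    unfolding F_def sgd_iterate_def
    by (intro measurable_sgd_inner[OF g] measurable_sgd_restarts[OF g] measurable_component_singleton)
       (auto simp: P_def)
  have G: "G \<in> ?MQ \<rightarrow>\<^sub>M D"
    unfolding G_def by (rule measurable_component_singleton) simp
  have FU: "X = (\<lambda>w. F (U w))"
  proof
    fix w
    have 1: "sgd_restarts g \<eta> T x (\<lambda>j s. \<xi> j s w) k = sgd_restarts g \<eta> T x (\<lambda>j s. U w (j, s)) k"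
      by (rule sgd_restarts_cong) (simp add: U_def P_def)
    show "X w = F (U w)"
      unfolding X_def F_def sgd_iterate_def 1 by (rule sgd_inner_cong) (simp add: U_def P_def)
  qed
  have GV: "\<xi> k t = (\<lambda>w. G (V w))" by (simp add: G_def V_def)
  show "X \<in> borel_measurable M" unfolding FU by (rule measurable_compose[OF U F])
  show "\<xi> k t \<in> M \<rightarrow>\<^sub>M D" unfolding GV by (rule measurable_compose[OF V G])
  have X: "distr M borel X = distr (distr M ?MP U) borel F"
    unfolding FU using U F by (simp add: distr_distr comp_def)
  have "distr M D (\<xi> k t) = D" using ss t by (simp add: sample_stream_def)
  then have D: "D = distr (distr M ?MQ V) D G"
    unfolding GV using V G by (simp add: distr_distr comp_def)
  have "distr M borel X \<Otimes>\<^sub>M D = distr (distr M ?MP U) borel F \<Otimes>\<^sub>M distr (distr M ?MQ V) D G"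
    using X D by simp
  also have "\<dots> = distr (distr M ?MP U \<Otimes>\<^sub>M distr M ?MQ V) (borel \<Otimes>\<^sub>M D) (\<lambda>(y, z). (F y, G z))"
    using F G by (intro pair_measure_distr)
      (auto simp flip: D intro: D.sigma_finite_measure_axioms)
  also have "\<dots> = distr M (borel \<Otimes>\<^sub>M D) (\<lambda>w. (F (U w), G (V w)))"
    unfolding UV using U V F G by (subst distr_distr) (auto simp: comp_def)
  finally show "distr M (borel \<Otimes>\<^sub>M D) (\<lambda>w. (X w, \<xi> k t w)) = distr M borel X \<Otimes>\<^sub>M D"
    by (simp add: FU GV)
qed

text \<open>\<open>\<alpha>\<close> and \<open>\<beta>\<close> stay open because the lemma has two
  uses: with crude constants it propagates integrability, and with \<open>q\<close> and
  \<open>r * (1 - q)\<close> it gives the contraction.\<close>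

lemma gap_step:
  fixes f :: "'a::euclidean_space \<Rightarrow> real" and x
  assumes smooth: "smooth_fun f gradf L"
    and es: "\<And>k. expected_smoothness D (g k) f gradf h A B C (b k)"
    and ss: "sample_stream M D T \<xi>" and t: "t < T" and \<eta>: "\<eta> k \<ge> 0"
    and le: "\<And>y. (\<integral>z. opt_gap f (y - \<eta> k *\<^sub>R g k y z) \<partial>D) \<le> \<alpha> * opt_gap f y + \<beta>"
  defines "\<gamma> \<equiv> \<lambda>t w. opt_gap f (sgd_iterate g \<eta> T x (\<lambda>j s. \<xi> j s w) k t)"
  assumes int: "integrable M (\<gamma> t)"
  shows "integrable M (\<gamma> (Suc t))"
    and "integral\<^sup>L M (\<gamma> (Suc t)) \<le> \<alpha> * integral\<^sup>L M (\<gamma> t) + \<beta>"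
proof -
  interpret prob_space M using ss by (simp add: sample_stream_def)
  have D: "prob_space D" using ss by (simp add: sample_stream_def)
  have g: "case_prod (g k) \<in> borel_measurable (borel \<Otimes>\<^sub>M D)" for k
    using es by (simp add: expected_smoothness_def)
  define v where "v y z = opt_gap f (y - \<eta> k *\<^sub>R g k y z)" for y z
  have "(\<lambda>z. fst z - \<eta> k *\<^sub>R case_prod (g k) z) \<in> borel_measurable (borel \<Otimes>\<^sub>M D)"
    using g[of k] by (intro borel_measurable_diff borel_measurable_scaleR measurable_fst) auto
  from measurable_compose[OF this opt_gap_borel[OF smooth]]
  have v: "case_prod v \<in> borel_measurable (borel \<Otimes>\<^sub>M D)"
    by (simp add: v_def case_prod_beta')
  have Suc: "\<gamma> (Suc t) = (\<lambda>w. v (sgd_iterate g \<eta> T x (\<lambda>j s. \<xi> j s w) k t) (\<xi> k t w))"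
    by (simp add: \<gamma>_def v_def sgd_iterate_def)
  note bound = expectation_le_of_conditional_bound[OF D distr_sgd_iterate_sample[OF g ss t] v
      _ opt_gap_borel[OF smooth] int[unfolded \<gamma>_def] _ le[folded v_def]]
  show "integrable M (\<gamma> (Suc t))"
    unfolding Suc by (rule bound(1))
      (auto simp: v_def opt_gap_nonneg[OF smooth] intro!: expected_descent(1)[OF smooth D es \<eta>])
  show "integral\<^sup>L M (\<gamma> (Suc t)) \<le> \<alpha> * integral\<^sup>L M (\<gamma> t) + \<beta>"
    unfolding Suc unfolding \<gamma>_def by (rule bound(2))
      (auto simp: v_def opt_gap_nonneg[OF smooth] intro!: expected_descent(1)[OF smooth D es \<eta>])
qed

section \<open>Real recursions, convergence rate and complexity\<close>

text \<open>Subtracting the fixed point \<open>r\<close> turns the affine map into multiplication by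
  \<open>q\<close>.\<close>

lemma affine_recursion_le:
  fixes z :: "nat \<Rightarrow> real"
  assumes "q \<ge> 0" and "\<And>t. t < T \<Longrightarrow> z (Suc t) \<le> q * z t + r * (1 - q)" and "n \<le> T"
  shows "z n - r \<le> q ^ n * (z 0 - r)"
  using assms(3)
proof (induction n)
  case (Suc n)
  have "z (Suc n) - r \<le> q * (z n - r)"
    using assms(2)[of n] Suc.prems by (simp add: algebra_simps)
  also have "\<dots> \<le> q * (q ^ n * (z 0 - r))"
    using Suc assms(1) by (intro mult_left_mono) auto
  finally show ?case by (simp add: mult.assoc)
qed simp

text \<open>A contraction factor \<open>exp (- c / k)\<close> with \<open>c > p\<close> beats the decay
  \<open>(1 + 1 / k) powr (- p) \<ge> exp (- p / k)\<close> of the target rate.\<close>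

lemma restart_recursion_rate:
  fixes \<delta> :: "nat \<Rightarrow> real"
  assumes p: "p \<ge> 0" and N: "N \<ge> 1" and R: "R \<ge> 0"
    and rec: "\<And>k. k \<ge> N \<Longrightarrow>
      \<delta> (Suc k) \<le> r k + exp (- ((p + 1) / real k)) * max (\<delta> k - r k) 0"
    and r: "\<And>k. k \<ge> N \<Longrightarrow> r k \<le> R * real k powr (- p)"
  shows "\<exists>Q>0. \<forall>k\<ge>N. \<delta> k \<le> Q * real k powr (- p)"
proof -
  \<comment> \<open>The summands serve, in order, positivity, the base case \<open>k = N\<close>,
    and the inequality \<open>gain\<close> in the induction step.\<close>
  define Q where "Q = 1 + \<bar>\<delta> N\<bar> * real N powr p + R * (p + 1) * exp (p + 1)"
  have "R * (p + 1) * exp (p + 1) \<ge> 0" using p R by simp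
  then have Q: "Q > 0" "Q \<ge> R * (p + 1) * exp (p + 1)" "Q \<ge> \<bar>\<delta> N\<bar> * real N powr p"
    by (auto simp: Q_def add_pos_nonneg)
  have "\<delta> k \<le> Q * real k powr (- p)" if "k \<ge> N" for k
    using that
  proof (induction k rule: dec_induct)
    case base
    have "\<delta> N \<le> \<bar>\<delta> N\<bar> * real N powr p * real N powr (- p)"
      using N by (simp add: mult.assoc flip: powr_add)
    also have "\<dots> \<le> Q * real N powr (- p)"
      using Q(3) by (intro mult_right_mono) auto
    finally show ?case .
  next
    case (step k)
    have k: "real k \<ge> 1" using step N by simp
    define e where "e = exp (- ((p + 1) / real k))"
    have e: "0 < e" "e \<le> 1" using p by (auto simp: e_def)
    have decay: "real (Suc k) powr (- p) \<ge> real k powr (- p) * exp (- (p / real k))"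
    proof -
      have "ln (real (Suc k)) \<le> ln (real k) + 1 / real k"
      proof -
        have "real (Suc k) = real k * (1 + 1 / real k)"
          using k by (simp add: field_simps)
        then have "ln (real (Suc k)) = ln (real k * (1 + 1 / real k))" by simp
        also have "\<dots> = ln (real k) + ln (1 + 1 / real k)"
          using k by (intro ln_mult_pos) (auto intro: add_pos_pos)
        also have "\<dots> \<le> ln (real k) + 1 / real k"
          using k by (simp add: ln_add_one_self_le_self)
        finally show ?thesis .
      qed
      then have "p * ln (real (Suc k)) \<le> p * (ln (real k) + 1 / real k)"
        using p by (rule mult_left_mono)
      then have "- p * ln (real k) + - p / real k \<le> - p * ln (real (Suc k))"
        by (simp add: algebra_simps)
      then have "exp (- p * ln (real k) + - p / real k) \<le> exp (- p * ln (real (Suc k)))"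
        by (simp only: exp_le_cancel_iff)
      then show ?thesis
        using k by (simp add: powr_def exp_add[symmetric])
    qed
    have exp_split: "exp (- (p / real k)) = e * exp (1 / real k)"
      by (simp add: e_def exp_add[symmetric] add_divide_distrib)
    \<comment> \<open>Both sides are of order \<open>1 / k\<close>: \<open>1 - e\<close> is at most
      \<open>(p + 1) / k\<close>, while the surplus 1 in the exponent of \<open>e\<close> makes the
      bracket at least \<open>e / k\<close>. Since \<open>k \<ge> 1\<close>, \<open>e\<close> is at
      least \<open>exp (- (p + 1))\<close>, whence the last summand of \<open>Q\<close>.\<close>
    have gain: "(1 - e) * R \<le> Q * (exp (- (p / real k)) - e)"
    proof -
      have "(1 - e) * R \<le> ((p + 1) / real k) * R"
        using exp_ge_add_one_self[of "- ((p + 1) / real k)", folded e_def] R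
        by (intro mult_right_mono) linarith+
      also have "\<dots> \<le> (R * (p + 1) * exp (p + 1)) * exp (- (p + 1)) * (1 / real k)"
        by (simp add: mult.commute mult.left_commute flip: exp_add)
      also have "\<dots> \<le> Q * e * (exp (1 / real k) - 1)"
      proof (intro mult_mono)
        show "exp (- (p + 1)) \<le> e"
        proof -
          have "(p + 1) / real k \<le> p + 1"
            using p k by (simp add: divide_le_eq mult_le_cancel_left1)
          then show ?thesis unfolding e_def exp_le_cancel_iff by simp
        qed
        show "1 / real k \<le> exp (1 / real k) - 1"
          using exp_ge_add_one_self[of "1 / real k"] by linarith
      qed (use Q e k in auto)
      also have "\<dots> = Q * (exp (- (p / real k)) - e)"
        by (simp add: exp_split algebra_simps)
      finally show ?thesis .
    qed
    let ?P = "real k powr (- p)"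
    have "\<delta> (Suc k) \<le> (1 - e) * (R * ?P) + e * (Q * ?P)"
    proof -
      \<comment> \<open>Because of the branch 0 of the maximum, \<open>r k \<le> Q * ?P\<close> is
        needed besides the induction hypothesis.\<close>
      have "R * 1 \<le> R * ((p + 1) * exp (p + 1))"
        using p R by (intro mult_left_mono) (auto intro!: mult_ge1_I)
      then have RQ: "R * ?P \<le> Q * ?P"
        using Q(2) by (intro mult_right_mono) (auto simp: mult.assoc)
      have "\<delta> (Suc k) \<le> r k + e * max (\<delta> k - r k) 0"
        using rec[OF step(1)] by (simp add: e_def)
      also have "\<dots> \<le> r k + e * (Q * ?P - r k)"
        using step RQ r[OF step(1)] e by (intro add_left_mono mult_left_mono) auto
      also have "\<dots> = (1 - e) * r k + e * (Q * ?P)" by (simp add: algebra_simps)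
      also have "\<dots> \<le> (1 - e) * (R * ?P) + e * (Q * ?P)"
        using r[OF step(1)] e by (intro add_right_mono mult_left_mono) auto
      finally show ?thesis .
    qed
    also have "\<dots> = ((1 - e) * R + e * Q) * ?P" by (simp add: algebra_simps)
    also have "\<dots> \<le> (Q * exp (- (p / real k))) * ?P"
      using gain by (intro mult_right_mono) (auto simp: algebra_simps)
    also have "\<dots> \<le> Q * real (Suc k) powr (- p)"
      using mult_left_mono[OF decay, of Q] Q(1) by (simp add: algebra_simps)
    finally show ?case .
  qed
  then show ?thesis using Q(1) by blast
qed

text \<open>Solving \<open>Q * y powr (- p) = \<epsilon>\<close> for \<open>y\<close> and rounding
  up gives a sufficient number of outer iterations. \<open>T\<close> is fixed while
  \<open>\<epsilon>\<close> tends to 0, so it enters the constant.\<close>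

lemma iteration_complexity_rate:
  fixes \<delta> :: "nat \<Rightarrow> real"
  assumes p: "p > 0" and Q: "Q > 0" and rate: "\<And>k. k \<ge> N \<Longrightarrow> \<delta> k \<le> Q * real k powr (- p)"
  shows "\<exists>Q'. \<forall>\<^sub>F \<epsilon> in at_right 0. iteration_complexity T \<delta> \<epsilon> \<le> ereal (Q' * \<epsilon> powr (- 1 / p))"
proof (intro exI)
  \<comment> \<open>Below this threshold \<open>y \<ge> N + 1\<close>: then
    \<open>K \<ge> N\<close>, so the rate applies at \<open>K\<close>, and \<open>y \<ge> 1\<close>,
    so rounding up at most doubles \<open>y\<close>.\<close>
  define \<epsilon>0 where "\<epsilon>0 = Q * (real N + 1) powr (- p)"
  have "\<epsilon>0 > 0" using Q by (simp add: \<epsilon>0_def)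
  then have "\<forall>\<^sub>F \<epsilon> in at_right (0::real). 0 < \<epsilon> \<and> \<epsilon> < \<epsilon>0"
    by (auto simp: eventually_at_right_field)
  then show "\<forall>\<^sub>F \<epsilon> in at_right 0. iteration_complexity T \<delta> \<epsilon> \<le>
      ereal (2 * real T * Q powr (1 / p) * \<epsilon> powr (- 1 / p))"
  proof eventually_elim
    case (elim \<epsilon>)
    define y where "y = (Q / \<epsilon>) powr (1 / p)"
    define K where "K = nat \<lceil>y\<rceil>"
    have "(real N + 1) powr p \<le> Q / \<epsilon>"
      using elim by (simp add: \<epsilon>0_def powr_minus field_simps)
    then have "((real N + 1) powr p) powr (1 / p) \<le> y"
      unfolding y_def using p by (intro powr_mono2) auto
    then have y: "y \<ge> real N + 1" using p by (simp add: powr_powr)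
    have K: "real K \<ge> y" "real K \<le> 2 * y" "K \<ge> N"
      using y unfolding K_def by linarith+
    have "Q / \<epsilon> = y powr p" using p Q elim by (simp add: y_def powr_powr)
    also have "\<dots> \<le> real K powr p" using K y p by (intro powr_mono2) auto
    finally have "Q * real K powr (- p) \<le> \<epsilon>"
      using elim K y by (simp add: powr_minus field_simps)
    with rate[OF K(3)] have "\<delta> K \<le> \<epsilon>" by simp
    then have "iteration_complexity T \<delta> \<epsilon> \<le> ereal (real (K * T))"
      unfolding iteration_complexity_def by (intro Inf_lower) auto
    also have "real (K * T) \<le> 2 * y * real T"
      using K(2) by (simp add: mult_right_mono)
    also have "2 * y * real T = 2 * real T * Q powr (1 / p) * \<epsilon> powr (- 1 / p)"
    proof -
      have "y = Q powr (1 / p) / \<epsilon> powr (1 / p)"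
        unfolding y_def by (rule powr_divide)
      moreover have "\<epsilon> powr (- 1 / p) = inverse (\<epsilon> powr (1 / p))"
        by (simp flip: powr_minus)
      ultimately show ?thesis by (simp add: divide_inverse)
    qed
    finally show ?case by simp
  qed
qed

section \<open>The convergence rate and iteration complexity of SGD with restarts\<close>

text \<open>Choosing \<open>c\<close> before all problem data makes the constant hidden in the
  condition on \<open>T\<close> depend only on \<open>\<zeta>\<close> and \<open>\<nu>\<close> (and
  the types). The complexity claim presupposes \<open>\<zeta> * \<nu> > 0\<close>, without which its
  exponent is meaningless.\<close>

theorem theorem1:
  fixes \<zeta> \<nu> :: real
  assumes "\<zeta> \<ge> 0" and "\<nu> \<ge> 0"
  shows "\<exists>c>0. \<forall>(f :: real ^ 'n \<Rightarrow> real) gradf L \<phi> \<phi>' h h' A B C b g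
           (D :: 's measure) (M :: 'w measure) \<xi> x\<^sub>0 \<eta> r \<omega> a d T.
     smooth_fun f gradf L \<longrightarrow>
     global_KL f gradf \<phi> \<longrightarrow>
     growth_fun h h' \<longrightarrow>
     A \<ge> 0 \<and> B \<ge> 0 \<and> C \<ge> 0 \<longrightarrow>
     (\<forall>k. b k > 0 \<and> expected_smoothness D (g k) f gradf h A B C (b k)) \<longrightarrow>
     sample_stream M D T \<xi> \<longrightarrow>
     a = L * A \<longrightarrow> d = L * C / 2 \<longrightarrow>
     (\<forall>k. \<eta> k > 0) \<longrightarrow>
     (\<forall>\<^sub>F k in sequentially. L * B * \<eta> k \<le> 1) \<longrightarrow>
     (\<forall>k. stationary_point a d h \<phi> (b k) (\<eta> k) (r k)) \<longrightarrow>
     \<eta> \<in> \<Theta>(\<lambda>k. real k powr (- \<zeta>)) \<longrightarrow>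
     r \<in> \<Theta>(\<lambda>k. real k powr (- (\<zeta> * \<nu>))) \<longrightarrow>
     (\<forall>k. \<bar>1 - \<omega> k\<bar> < 1) \<longrightarrow>
     (\<forall>k\<ge>1. (\<phi> has_real_derivative \<phi>' (r k)) (at (r k) within {0..}) \<and>
        1 + a * (\<eta> k)\<^sup>2 * h' (r k) - \<eta> k * \<phi>' (r k) * \<phi> (r k) = 1 - \<omega> k * inverse (real k)) \<longrightarrow>
     (INF j. \<omega> j) > 0 \<longrightarrow>
     real T \<ge> c * (1 / (INF j. \<omega> j)) \<longrightarrow>
     (let gap = restart_gap f g \<eta> T x\<^sub>0 \<xi>;
          \<delta> = (\<lambda>k. integral\<^sup>L M (gap k))
      in (\<forall>k. integrable M (gap k)) \<and>
         \<delta> \<in> O(\<lambda>k. real k powr (- (\<zeta> * \<nu>))) \<and>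
         (\<zeta> * \<nu> > 0 \<longrightarrow>
           (\<exists>Q. \<forall>\<^sub>F \<epsilon> in at_right 0.
              iteration_complexity T \<delta> \<epsilon> \<le> ereal (Q * \<epsilon> powr (- 1 / (\<zeta> * \<nu>))))))"
proof -
  define p where "p = \<zeta> * \<nu>"
  have p: "p \<ge> 0" using assms by (simp add: p_def)
  have main: "(\<forall>k. integrable M (restart_gap f g \<eta> T x\<^sub>0 \<xi> k)) \<and>
      (\<exists>Q>0. \<exists>N. \<forall>k\<ge>N. integral\<^sup>L M (restart_gap f g \<eta> T x\<^sub>0 \<xi> k) \<le> Q * real k powr (- p))"
    if smooth: "smooth_fun f gradf L" and KL: "global_KL f gradf \<phi>" and h: "growth_fun h h'"
      and ABC: "A \<ge> 0 \<and> B \<ge> 0 \<and> C \<ge> 0"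
      and bes: "\<forall>k. b k > 0 \<and> expected_smoothness D (g k) f gradf h A B C (b k)"
      and ss: "sample_stream M D T \<xi>" and a: "a = L * A" and d: "d = L * C / 2"
      and \<eta>: "\<forall>k. \<eta> k > 0" and small: "\<forall>\<^sub>F k in sequentially. L * B * \<eta> k \<le> 1"
      and stat: "\<forall>k. stationary_point a d h \<phi> (b k) (\<eta> k) (r k)"
      and r\<Theta>: "r \<in> \<Theta>(\<lambda>k. real k powr (- (\<zeta> * \<nu>)))"
      and \<omega>: "\<forall>k. \<bar>1 - \<omega> k\<bar> < 1"
      and slope: "\<forall>k\<ge>1. (\<phi> has_real_derivative \<phi>' (r k)) (at (r k) within {0..}) \<and>
        1 + a * (\<eta> k)\<^sup>2 * h' (r k) - \<eta> k * \<phi>' (r k) * \<phi> (r k) = 1 - \<omega> k * inverse (real k)"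
      and \<omega>_Inf: "(INF j. \<omega> j) > 0" and T: "real T \<ge> (p + 1) * (1 / (INF j. \<omega> j))"
    for f :: "real ^ 'n \<Rightarrow> real" and gradf L \<phi> \<phi>' h h' A B C b g
      and D :: "'s measure" and M :: "'w measure" and \<xi> x\<^sub>0 \<eta> r \<omega> a d T
  proof -
    interpret prob_space M using ss by (simp add: sample_stream_def)
    have D: "prob_space D" using ss by (simp add: sample_stream_def)
    have es: "expected_smoothness D (g k) f gradf h A B C (b k)" for k using bes by blast
    have \<eta>0: "\<eta> k \<ge> 0" for k using \<eta> by (simp add: less_imp_le)
    define \<gamma> where "\<gamma> k t w = opt_gap f (sgd_iterate g \<eta> T x\<^sub>0 (\<lambda>j s. \<xi> j s w) k t)" for k t w
    have \<gamma>_0: "\<gamma> k 0 = restart_gap f g \<eta> T x\<^sub>0 \<xi> k"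
      and \<gamma>_T: "\<gamma> k T = restart_gap f g \<eta> T x\<^sub>0 \<xi> (Suc k)" for k
      by (auto simp: \<gamma>_def restart_gap_def sgd_iterate_def)
    note step = gap_step[where g = g and \<eta> = \<eta> and x = x\<^sub>0, OF smooth es ss _ \<eta>0, folded \<gamma>_def]
    have inner_int: "integrable M (\<gamma> k t)" if "integrable M (\<gamma> k 0)" "t \<le> T" for k t
      using that(2)
    proof (induction t)
      case (Suc t)
      \<comment> \<open>Integrability is claimed for every \<open>k\<close>, whereas the contraction
        is available only from \<open>N\<close> on; hence the crude bound.\<close>
      obtain \<alpha> \<beta> where "\<And>y. (\<integral>z. opt_gap f (y - \<eta> k *\<^sub>R g k y z) \<partial>D) \<le> \<alpha> * opt_gap f y + \<beta>"
        using expected_gap_affine_bound[OF smooth D es \<eta>0 h] ABC by metis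
      then show ?case by (rule step(1)[rotated]) (use Suc in auto)
    qed (use that in simp)
    have gap_int: "integrable M (restart_gap f g \<eta> T x\<^sub>0 \<xi> k)" for k
    proof (induction k)
      case 0
      have "restart_gap f g \<eta> T x\<^sub>0 \<xi> 0 = (\<lambda>w. opt_gap f x\<^sub>0)"
        by (simp add: restart_gap_def fun_eq_iff)
      then show ?case by simp
    next
      case (Suc k)
      then show ?case using inner_int[of k T] by (simp add: \<gamma>_0 \<gamma>_T)
    qed
    let ?\<delta> = "\<lambda>k. integral\<^sup>L M (restart_gap f g \<eta> T x\<^sub>0 \<xi> k)"
    obtain R where R: "R > 0" "\<forall>\<^sub>F k in sequentially. norm (r k) \<le> R * norm (real k powr (- p))"
      using r\<Theta> landau_o.bigE[OF bigthetaD1] unfolding p_def by metis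
    \<comment> \<open>From \<open>k \<ge> 2\<close> and \<open>\<omega> k < 2\<close> the factor
      \<open>1 - \<omega> k / k\<close> is nonnegative, so that its powers preserve
      inequalities.\<close>
    obtain N where N: "N \<ge> 2" "\<And>k. k \<ge> N \<Longrightarrow> L * B * \<eta> k \<le> 1"
      "\<And>k. k \<ge> N \<Longrightarrow> norm (r k) \<le> R * norm (real k powr (- p))"
    proof -
      from eventually_conj[OF small R(2)] obtain N where
        "\<And>k. k \<ge> N \<Longrightarrow> L * B * \<eta> k \<le> 1 \<and> norm (r k) \<le> R * norm (real k powr (- p))"
        unfolding eventually_sequentially by blast
      then show thesis by (intro that[of "max N 2"]) auto
    qed
    have "\<exists>Q>0. \<forall>k\<ge>N. ?\<delta> k \<le> Q * real k powr (- p)"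
    proof (rule restart_recursion_rate[OF p, where R = R and r = r])
      show "r k \<le> R * real k powr (- p)" if "k \<ge> N" for k
        using N(3)[OF that] by simp
      show "?\<delta> (Suc k) \<le> r k + exp (- ((p + 1) / real k)) * max (?\<delta> k - r k) 0" if k: "k \<ge> N" for k
      proof -
        define q where "q = 1 - \<omega> k * inverse (real k)"
        have k2: "real k \<ge> 2" using k N(1) by simp
        have \<omega>k: "0 < \<omega> k" "\<omega> k < 2" using \<omega>[rule_format, of k] by linarith+
        have q0: "q \<ge> 0" using k2 \<omega>k by (simp add: q_def field_simps)
        have le: "(\<integral>z. opt_gap f (y - \<eta> k *\<^sub>R g k y z) \<partial>D) \<le> q * opt_gap f y + r k * (1 - q)" for y
        proof (rule expected_gap_contraction[OF smooth D es \<eta>0 h _ KL N(2)[OF k]])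
          show "stationary_point (L * A) (L * C / 2) h \<phi> (b k) (\<eta> k) (r k)"
            using stat by (simp add: a d)
          show "(\<phi> has_real_derivative \<phi>' (r k)) (at (r k) within {0..})"
            "q = 1 + L * A * (\<eta> k)\<^sup>2 * h' (r k) - \<eta> k * \<phi>' (r k) * \<phi> (r k)"
            using slope[rule_format, of k] k2 by (simp_all add: a q_def)
        qed (use ABC in simp)
        have "?\<delta> (Suc k) - r k \<le> q ^ T * (?\<delta> k - r k)"
          using affine_recursion_le[of q T "\<lambda>t. integral\<^sup>L M (\<gamma> k t)" "r k" T] q0
            step(2)[OF _ le inner_int] gap_int[of k] by (simp add: \<gamma>_0 \<gamma>_T)
        \<comment> \<open>\<open>?\<delta> k\<close> may lie below \<open>r k\<close>; enlarging
          \<open>q ^ T\<close> to the exponential is sound only in front of a nonnegative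
          factor.\<close>
        also have "\<dots> \<le> q ^ T * max (?\<delta> k - r k) 0"
          using q0 by (intro mult_left_mono) auto
        also have "\<dots> \<le> exp (- ((p + 1) / real k)) * max (?\<delta> k - r k) 0"
        proof (rule mult_right_mono)
          have "(INF j. \<omega> j) \<le> \<omega> k"
          \<comment> \<open>A real infimum is a lower bound only if the range is bounded below,
            which follows from \<open>\<bar>1 - \<omega> j\<bar> < 1\<close>.\<close>
          proof (rule cINF_lower)
            have "0 \<le> \<omega> j" for j using \<omega>[rule_format, of j] by linarith
            then show "bdd_below (range \<omega>)" by (auto intro!: bdd_belowI[of _ 0])
          qed simp
          then have "p + 1 \<le> \<omega> k * real T"
            using T \<omega>_Inf mult_right_mono[of "INF j. \<omega> j" "\<omega> k" "real T"]
            by (simp add: pos_divide_le_eq mult.commute)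
          then have "(p + 1) / real k \<le> \<omega> k * real T / real k"
            by (rule divide_right_mono) simp
          moreover have "\<omega> k * real T / real k = real T * (\<omega> k * inverse (real k))"
            by (simp add: divide_inverse)
          moreover have "q ^ T \<le> exp (- (\<omega> k * inverse (real k))) ^ T"
            using q0 exp_ge_add_one_self[of "- (\<omega> k * inverse (real k))"]
            by (intro power_mono) (auto simp: q_def)
          moreover have "\<dots> = exp (- (real T * (\<omega> k * inverse (real k))))"
            by (simp flip: exp_of_nat_mult)
          ultimately show "q ^ T \<le> exp (- ((p + 1) / real k))"
            by (smt (verit) exp_le_cancel_iff)
        qed simp
        finally show ?thesis by simp
      qed
    qed (use N R in auto)
    with gap_int show ?thesis by blast
  qed
  show ?thesis
  \<comment> \<open>With \<open>c = p + 1\<close> the exponent of the contraction exceeds that of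
    the target rate by 1, as \<open>restart_recursion_rate\<close> requires.\<close>
  proof (intro exI[of _ "p + 1"] conjI allI impI, goal_cases)
    case 1
    then show ?case using p by simp
  next
    case (2 f gradf L \<phi> \<phi>' h h' A B C b g D M \<xi> x\<^sub>0 \<eta> r \<omega> a d T)
    let ?\<delta> = "\<lambda>k. integral\<^sup>L M (restart_gap f g \<eta> T x\<^sub>0 \<xi> k)"
    note smooth = 2(1)
    obtain Q N where int: "\<And>k. integrable M (restart_gap f g \<eta> T x\<^sub>0 \<xi> k)"
      and Q: "Q > 0" "\<And>k. k \<ge> N \<Longrightarrow> ?\<delta> k \<le> Q * real k powr (- p)"
      using main[OF 2(1-11) 2(13-17)] by blast
    \<comment> \<open>\<open>main\<close> bounds \<open>?\<delta>\<close> from above only, but the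
      Landau symbol concerns its absolute value.\<close>
    have pos: "?\<delta> k \<ge> 0" for k
      by (intro Bochner_Integration.integral_nonneg) (simp add: restart_gap_def opt_gap_nonneg[OF smooth])
    have "?\<delta> \<in> O(\<lambda>k. real k powr (- p))"
      by (rule bigoI[of _ Q]) (use Q pos in \<open>auto simp: eventually_sequentially\<close>)
    moreover have "\<exists>Q'. \<forall>\<^sub>F \<epsilon> in at_right 0.
        iteration_complexity T ?\<delta> \<epsilon> \<le> ereal (Q' * \<epsilon> powr (- 1 / p))" if "p > 0"
      using iteration_complexity_rate[OF that Q] by blast
    ultimately show ?case
      unfolding Let_def p_def[symmetric] using int by blast
  qed
qed

end
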